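(* The system $\{r_i\otimes r_j\}_{1\le i<\infty,\,1\le j<\infty}$ is a system of random unconditional convergence in $L_\infty([0,1]^2)$, i.e., there exists a universal constant $C>0$ such that for all $n,m\in\mathbb{N}$ and all $a_{i,j}\in\mathbb{R}$, $1\le i\le n$, $1\le j\le m$, $$ \mathsf{E}_\theta\Bigl\|\sum_{i=1}^{n}\sum_{j=1}^{m}\theta_{i,j}a_{i,j}\,r_i\otimes r_j\Bigr\|_{L_\infty([0,1]^2)}\le C\,\Big\|\sum_{i=1}^{n}\sum_{j=1}^{m}a_{i,j}\,r_i\otimes r_j\Big\|_{L_\infty([0,1]^2)}. $$
   Context: The Rademacher functions are $r_i(t)=(-1)^{[2^i t]}$, $t\in[0,1]$, $i=1,2,\dots$, where $[x]$ is the integer part of $x$; $(r_i\otimes r_j)(u,v)=r_i(u)r_j(v)$ for $(u,v)\in[0,1]^2$. $\mathsf{E}_\theta$ denotes the expectation (uniform average) over all arrangements of signs $\theta_{i,j}=\pm1$. *)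

theory Defs
  imports "HOL-Probability.Probability"
begin

definition rademacher :: "nat \<Rightarrow> real \<Rightarrow> real" where
  "rademacher i t = (-1) powi \<lfloor>2 ^ i * t\<rfloor>"

definition rademacher_tensor :: "nat \<Rightarrow> nat \<Rightarrow> real \<times> real \<Rightarrow> real" where
  "rademacher_tensor i j = (\<lambda>(u, v). rademacher i u * rademacher j v)"

text \<open>The conversion \<^const>\<open>real_of_ereal\<close> sends infinity to 0, so this is the
  \<open>L\<^sub>\<infinity>\<close>-norm only for essentially bounded measurable functions; see \<open>ereal_Linf_norm\<close>.\<close>

definition Linf_norm :: "'a measure \<Rightarrow> ('a \<Rightarrow> real) \<Rightarrow> real" where
  "Linf_norm M f = real_of_ereal (esssup M (\<lambda>x. ereal \<bar>f x\<bar>))"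

abbreviation unit_square :: "(real \<times> real) measure" where
  "unit_square \<equiv> lebesgue_on ({0..1} \<times> {0..1})"

definition sign_arrangements :: "nat \<Rightarrow> nat \<Rightarrow> (nat \<times> nat \<Rightarrow> real) set" where
  "sign_arrangements n m = ({1..n} \<times> {1..m}) \<rightarrow>\<^sub>E {-1, 1}"

definition sign_expectation :: "nat \<Rightarrow> nat \<Rightarrow> ((nat \<times> nat \<Rightarrow> real) \<Rightarrow> real) \<Rightarrow> real" where
  "sign_expectation n m F = measure_pmf.expectation (pmf_of_set (sign_arrangements n m)) F"

lemma ereal_Linf_norm:
  assumes "f \<in> borel_measurable M" "AE x in M. \<bar>f x\<bar> \<le> c" "emeasure M (space M) \<noteq> 0"
  shows "ereal (Linf_norm M f) = esssup M (\<lambda>x. ereal \<bar>f x\<bar>)"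
proof -
  have meas: "(\<lambda>x. ereal \<bar>f x\<bar>) \<in> borel_measurable M"
    using assms(1) by measurable
  have "esssup M (\<lambda>x. ereal \<bar>f x\<bar>) \<le> ereal c"
    using meas assms(2) by (intro esssup_I) auto
  moreover have "esssup M (\<lambda>x. 0 :: ereal) \<le> esssup M (\<lambda>x. ereal \<bar>f x\<bar>)"
    using meas by (intro esssup_mono) auto
  then have "0 \<le> esssup M (\<lambda>x. ereal \<bar>f x\<bar>)"
    using esssup_const[OF assms(3), of "0 :: ereal"] by simp
  ultimately have "\<bar>esssup M (\<lambda>x. ereal \<bar>f x\<bar>)\<bar> \<noteq> \<infinity>"
    by (cases "esssup M (\<lambda>x. ereal \<bar>f x\<bar>)") auto
  then show ?thesis
    unfolding Linf_norm_def by (simp add: ereal_real)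
qed

lemma abs_rademacher [simp]: "\<bar>rademacher i t\<bar> = 1"
  by (simp add: rademacher_def power_int_abs)

lemma borel_measurable_rademacher [measurable]: "rademacher i \<in> borel_measurable borel"
proof -
  have "(\<lambda>t :: real. \<lfloor>2 ^ i * t\<rfloor>) \<in> borel \<rightarrow>\<^sub>M count_space UNIV"
    by measurable
  then have "(\<lambda>t :: real. (\<lambda>k. (-1 :: real) powi k) \<lfloor>2 ^ i * t\<rfloor>) \<in> borel_measurable borel"
    by (rule measurable_compose) simp
  then show ?thesis
    by (simp add: rademacher_def [abs_def])
qed

lemma borel_measurable_rademacher_tensor:
  "rademacher_tensor i j \<in> borel_measurable unit_square"
proof -
  have "rademacher_tensor i j \<in> borel_measurable borel"
    unfolding rademacher_tensor_def borel_prod [symmetric] by measurable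
  then show ?thesis
    by (intro measurable_restrict_space1 measurable_completion) simp
qed

lemma emeasure_unit_square: "emeasure unit_square (space unit_square) = 1"
proof -
  have "{0..1} \<times> {0..1} = cbox (0 :: real, 0 :: real) (1, 1)"
    by (simp add: cbox_Pair_eq)
  moreover have "emeasure lborel (cbox (0 :: real, 0 :: real) (1, 1)) = 1"
    by (simp add: emeasure_lborel_cbox_eq Basis_prod_def inner_Pair prod.union_disjoint)
  ultimately show ?thesis
    by (simp add: emeasure_restrict_space space_restrict_space)
qed

lemma ereal_Linf_norm_rademacher_sum:
  fixes b :: "nat \<Rightarrow> nat \<Rightarrow> real" and n m :: nat
  defines "f \<equiv> \<lambda>x. \<Sum>i=1..n. \<Sum>j=1..m. b i j * rademacher_tensor i j x"
  shows "ereal (Linf_norm unit_square f) = esssup unit_square (\<lambda>x. ereal \<bar>f x\<bar>)"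
proof (rule ereal_Linf_norm)
  show "f \<in> borel_measurable unit_square"
    unfolding f_def
    by (intro borel_measurable_sum borel_measurable_times borel_measurable_const
        borel_measurable_rademacher_tensor)
  have "\<bar>f x\<bar> \<le> (\<Sum>i=1..n. \<Sum>j=1..m. \<bar>b i j\<bar>)" for x
    unfolding f_def
    by (intro order_trans[OF sum_abs] sum_mono order_trans[OF sum_abs])
       (auto simp: abs_mult rademacher_tensor_def split: prod.split)
  then show "AE x in unit_square. \<bar>f x\<bar> \<le> (\<Sum>i=1..n. \<Sum>j=1..m. \<bar>b i j\<bar>)"
    by simp
  show "emeasure unit_square (space unit_square) \<noteq> 0"
    unfolding emeasure_unit_square by simp
qed

lemma sign_expectation_eq:
  "sign_expectation n m F = (\<Sum>\<theta>\<in>sign_arrangements n m. F \<theta>) / 2 ^ (n * m)"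
proof -
  have fin: "finite (sign_arrangements n m)"
    unfolding sign_arrangements_def by (intro finite_PiE) auto
  have ne: "sign_arrangements n m \<noteq> {}"
    unfolding sign_arrangements_def by (simp add: PiE_eq_empty_iff)
  have "card (sign_arrangements n m) = 2 ^ (n * m)"
    unfolding sign_arrangements_def by (simp add: card_PiE numeral_2_eq_2)
  then show ?thesis
    unfolding sign_expectation_def by (simp add: integral_pmf_of_set[OF ne fin])
qed

end

theory Submission
  imports Defs
begin

text \<open>
  Both sides are norms of bilinear forms on sign vectors: every pair of sign patterns
  \<open>(\<epsilon>, \<delta>)\<close> is attained by the Rademacher functions on a whole dyadic rectangle, so the
  \<open>L\<^sub>\<infinity>\<close>-norm of \<open>\<Sum> b\<^sub>i\<^sub>j r\<^sub>i \<otimes> r\<^sub>j\<close> is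
  \<open>\<parallel>b\<parallel> = max\<^sub>\<epsilon>\<^sub>,\<^sub>\<delta> \<bar>\<Sum> b\<^sub>i\<^sub>j \<epsilon>\<^sub>i \<delta>\<^sub>j\<bar> = max\<^sub>\<delta> \<Sum>\<^sub>i \<bar>\<Sum>\<^sub>j b\<^sub>i\<^sub>j \<delta>\<^sub>j\<bar>\<close>
  (\<open>Linf_norm_le\<close>, \<open>sign_form_le_Linf_norm\<close>).

  Write \<open>f\<^sub>i(\<theta>, \<delta>) = \<Sum>\<^sub>j \<theta>\<^sub>i\<^sub>j a\<^sub>i\<^sub>j \<delta>\<^sub>j\<close>. The rows of \<open>\<theta>\<close> are independent and symmetric, so
  the absolute values in \<open>E max\<^sub>\<delta> \<Sum>\<^sub>i \<bar>f\<^sub>i\<bar>\<close> can be removed one row at a time, the price being the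
  mean \<open>E \<bar>f\<^sub>i\<bar>\<close> of the row and a factor \<open>2\<close>:
  \<open>E max\<^sub>\<delta> \<Sum>\<^sub>i \<bar>f\<^sub>i\<bar> \<le> \<Sum>\<^sub>i E \<bar>f\<^sub>i\<bar> + 2 E max\<^sub>\<delta> \<Sum>\<^sub>i f\<^sub>i\<close> (\<open>avg_Max_sum_abs_le\<close>).
  This combines symmetrization with the contraction principle.

  Each of the two terms on the right is controlled by \<open>\<parallel>a\<parallel>\<close>, by invariance of the uniform
  distribution under multiplication by a fixed sign vector. The first one is the average over sign
  vectors \<open>x\<close> of \<open>\<Sum>\<^sub>i \<bar>\<Sum>\<^sub>j a\<^sub>i\<^sub>j x\<^sub>j\<bar> \<le> \<parallel>a\<parallel>\<close>. In the second,
  \<open>max\<^sub>\<delta> \<Sum>\<^sub>i f\<^sub>i = \<Sum>\<^sub>j \<bar>\<Sum>\<^sub>i \<theta>\<^sub>i\<^sub>j a\<^sub>i\<^sub>j\<bar>\<close>, whose mean is the average over sign vectors \<open>w\<close> of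
  \<open>\<Sum>\<^sub>j \<bar>\<Sum>\<^sub>i w\<^sub>i a\<^sub>i\<^sub>j\<bar> \<le> \<parallel>a\<parallel>\<close>. Hence the theorem holds with \<open>C = 3\<close>.
\<close>

section \<open>Averages over finite sets\<close>

definition avg :: "'a set \<Rightarrow> ('a \<Rightarrow> real) \<Rightarrow> real" where
  "avg S F = (\<Sum>x\<in>S. F x) / real (card S)"

lemma avg_mono: "(\<And>x. x \<in> S \<Longrightarrow> F x \<le> G x) \<Longrightarrow> avg S F \<le> avg S G"
  unfolding avg_def by (intro divide_right_mono sum_mono) auto

lemma avg_cong: "(\<And>x. x \<in> S \<Longrightarrow> F x = G x) \<Longrightarrow> avg S F = avg S G"
  unfolding avg_def by (simp cong: sum.cong)

lemma avg_const: "finite S \<Longrightarrow> S \<noteq> {} \<Longrightarrow> avg S (\<lambda>_. c) = c"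
  unfolding avg_def by simp

lemma avg_add: "avg S (\<lambda>x. F x + G x) = avg S F + avg S G"
  unfolding avg_def by (simp add: sum.distrib add_divide_distrib)

lemma avg_diff: "avg S (\<lambda>x. F x - G x) = avg S F - avg S G"
  unfolding avg_def by (simp add: sum_subtractf diff_divide_distrib)

lemma avg_mult_left: "avg S (\<lambda>x. c * F x) = c * avg S F"
  unfolding avg_def by (simp add: sum_distrib_left)

lemma avg_sum: "avg S (\<lambda>x. \<Sum>i\<in>I. F i x) = (\<Sum>i\<in>I. avg S (F i))"
  unfolding avg_def by (subst sum.swap) (simp add: sum_divide_distrib)

lemma avg_le: "finite S \<Longrightarrow> S \<noteq> {} \<Longrightarrow> (\<And>x. x \<in> S \<Longrightarrow> F x \<le> c) \<Longrightarrow> avg S F \<le> c"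
  using avg_mono[of S F "\<lambda>_. c"] by (simp add: avg_const)

lemma avg_swap: "avg S (\<lambda>x. avg T (\<lambda>y. F x y)) = avg T (\<lambda>y. avg S (\<lambda>x. F x y))"
  unfolding avg_def
  by (simp add: sum_divide_distrib[symmetric] sum.swap[of F T S] mult.commute)

lemma avg_reindex: "bij_betw h S T \<Longrightarrow> avg S (\<lambda>x. F (h x)) = avg T F"
  unfolding avg_def by (simp add: sum.reindex_bij_betw bij_betw_same_card)

lemma avg_PiE_insert:
  assumes "finite I" "i \<notin> I"
  shows "avg (PiE (insert i I) T) F = avg (PiE I T) (\<lambda>z. avg (T i) (\<lambda>y. F (z(i := y))))"
proof -
  have bij: "bij_betw (\<lambda>(y, z). z(i := y)) (T i \<times> PiE I T) (PiE (insert i I) T)"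
    using inj_combinator[OF assms(2), of T] by (simp add: bij_betw_def PiE_insert_eq)
  have "(\<Sum>z\<in>PiE (insert i I) T. F z) = (\<Sum>y\<in>T i. \<Sum>z\<in>PiE I T. F (z(i := y)))"
    using sum.reindex_bij_betw[OF bij, of F]
    by (simp add: sum.cartesian_product case_prod_unfold)
  moreover have "card (PiE (insert i I) T) = card (T i) * card (PiE I T)"
    using bij_betw_same_card[OF bij] by (simp add: card_cartesian_product)
  ultimately show ?thesis
    unfolding avg_def
    by (simp add: sum_divide_distrib[symmetric] mult.commute) (subst sum.swap, simp)
qed

section \<open>Removing absolute values from a maximum of sums\<close>

text \<open>
  One random row \<open>z\<close> with a symmetric distribution. Subtracting the mean of \<open>\<bar>g z \<delta>\<bar>\<close> inside the
  maximum and writing that mean with an independent copy \<open>z'\<close> of \<open>z\<close> bounds the left-hand side by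
  \<open>\<mu>\<close> plus the mean of \<open>P z z' = max\<^sub>\<delta> (\<bar>g z \<delta>\<bar> - \<bar>g z' \<delta>\<bar> + r \<delta>)\<close>. In the sum of
  \<open>P z z'\<close> and \<open>P z' z\<close>, with maximizers \<open>\<delta>\<close> and \<open>\<delta>'\<close>, the terms can be regrouped so that each
  absolute value is subtracted from one for the same row: this leaves
  \<open>\<bar>g z \<delta> - g z \<delta>'\<bar> + \<bar>g z' \<delta> - g z' \<delta>'\<bar> + r \<delta> + r \<delta>'\<close>. Whatever the signs of the two
  differences, this is at most half the sum of the four values of
  \<open>max\<^sub>\<delta> (2 g \<cdot> \<delta> + r \<delta>)\<close> at \<open>z\<close>, \<open>z'\<close> and their negatives.
\<close>

lemma avg_Max_abs_add_le:
  fixes g :: "'z \<Rightarrow> 'd \<Rightarrow> real" and r :: "'d \<Rightarrow> real"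
  assumes T: "finite T" "T \<noteq> {}" and D: "finite D" "D \<noteq> {}"
    and neg: "bij_betw neg T T" "\<And>z \<delta>. z \<in> T \<Longrightarrow> \<delta> \<in> D \<Longrightarrow> g (neg z) \<delta> = - g z \<delta>"
    and mean: "\<And>\<delta>. \<delta> \<in> D \<Longrightarrow> avg T (\<lambda>z. \<bar>g z \<delta>\<bar>) \<le> \<mu>"
  shows "avg T (\<lambda>z. MAX \<delta>\<in>D. \<bar>g z \<delta>\<bar> + r \<delta>) \<le> \<mu> + avg T (\<lambda>z. MAX \<delta>\<in>D. 2 * g z \<delta> + r \<delta>)"
proof -
  define P where "P z z' = (MAX \<delta>\<in>D. \<bar>g z \<delta>\<bar> - \<bar>g z' \<delta>\<bar> + r \<delta>)" for z z'
  define Q where "Q z = (MAX \<delta>\<in>D. 2 * g z \<delta> + r \<delta>)" for z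
  have centre: "(MAX \<delta>\<in>D. \<bar>g z \<delta>\<bar> + r \<delta>) \<le> \<mu> + avg T (P z)" for z
  proof -
    have "\<bar>g z \<delta>\<bar> + r \<delta> \<le> \<mu> + avg T (P z)" if \<delta>: "\<delta> \<in> D" for \<delta>
    proof -
      have "\<bar>g z \<delta>\<bar> + r \<delta> - avg T (\<lambda>z'. \<bar>g z' \<delta>\<bar>) = avg T (\<lambda>z'. \<bar>g z \<delta>\<bar> + r \<delta> - \<bar>g z' \<delta>\<bar>)"
        by (simp add: avg_diff avg_const T)
      also have "\<dots> \<le> avg T (P z)"
        unfolding P_def using D \<delta> by (intro avg_mono Max_ge) (auto simp: image_iff algebra_simps)
      finally show ?thesis
        using mean[OF \<delta>] by linarith
    qed
    then show ?thesis
      using D by (subst Max_le_iff) auto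
  qed
  have Q_ge: "2 * g z \<delta> + r \<delta> \<le> Q z" if "\<delta> \<in> D" for z \<delta>
    unfolding Q_def using D that by (intro Max_ge) auto
  have difference: "2 * \<bar>g z \<delta> - g z \<delta>'\<bar> + r \<delta> + r \<delta>' \<le> Q z + Q (neg z)"
    if "z \<in> T" "\<delta> \<in> D" "\<delta>' \<in> D" for z \<delta> \<delta>'
    using Q_ge[of \<delta> z] Q_ge[of \<delta>' z] Q_ge[of \<delta> "neg z"] Q_ge[of \<delta>' "neg z"] neg(2) that
    by (auto simp: abs_if)
  have regroup: "P z z' + P z' z \<le> (1 / 2) * (Q z + Q (neg z) + (Q z' + Q (neg z')))"
    if z: "z \<in> T" "z' \<in> T" for z z'
  proof -
    have attained: "P x x' \<in> (\<lambda>\<delta>. \<bar>g x \<delta>\<bar> - \<bar>g x' \<delta>\<bar> + r \<delta>) ` D" for x x'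
      unfolding P_def using D by (intro Max_in) auto
    obtain \<delta> where \<delta>: "\<delta> \<in> D" "P z z' = \<bar>g z \<delta>\<bar> - \<bar>g z' \<delta>\<bar> + r \<delta>"
      using attained[of z z'] by blast
    obtain \<delta>' where \<delta>': "\<delta>' \<in> D" "P z' z = \<bar>g z' \<delta>'\<bar> - \<bar>g z \<delta>'\<bar> + r \<delta>'"
      using attained[of z' z] by blast
    show ?thesis
      using difference[OF z(1) \<delta>(1) \<delta>'(1)] difference[OF z(2) \<delta>(1) \<delta>'(1)]
        abs_triangle_ineq2[of "g z \<delta>" "g z \<delta>'"] abs_triangle_ineq2_sym[of "g z' \<delta>'" "g z' \<delta>"]
      unfolding \<delta>(2) \<delta>'(2) by argo
  qed
  have "avg T (\<lambda>z. avg T (P z)) + avg T (\<lambda>z. avg T (\<lambda>z'. P z' z))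
      = avg T (\<lambda>z. avg T (\<lambda>z'. P z z' + P z' z))"
    by (simp add: avg_add)
  also have "\<dots> \<le> avg T (\<lambda>z. avg T (\<lambda>z'. (1 / 2) * (Q z + Q (neg z) + (Q z' + Q (neg z')))))"
    by (intro avg_mono regroup)
  also have "\<dots> = 2 * avg T Q"
    by (simp only: avg_mult_left avg_add avg_const T avg_reindex[OF neg(1), of Q])
       (simp add: avg_mult_left avg_add avg_const T avg_reindex[OF neg(1), of Q])
  finally have "avg T (\<lambda>z. avg T (P z)) \<le> avg T Q"
    using avg_swap[of T T P] by simp
  then have "avg T (\<lambda>z. \<mu> + avg T (P z)) \<le> \<mu> + avg T Q"
    by (simp add: avg_add avg_const T)
  moreover have "avg T (\<lambda>z. MAX \<delta>\<in>D. \<bar>g z \<delta>\<bar> + r \<delta>) \<le> avg T (\<lambda>z. \<mu> + avg T (P z))"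
    by (intro avg_mono centre)
  ultimately show ?thesis
    unfolding Q_def by linarith
qed

text \<open>
  The rows of \<open>z\<close> are independent, so the previous bound applies to each of them in turn, the
  contribution of the other rows playing the part of \<open>r\<close>. Keeping \<open>r\<close> arbitrary is what makes
  the induction work.
\<close>

lemma avg_Max_sum_abs_le:
  fixes g :: "'i \<Rightarrow> 'z \<Rightarrow> 'd \<Rightarrow> real" and r :: "'d \<Rightarrow> real"
  assumes I: "finite I" and T: "finite T" "T \<noteq> {}" and D: "finite D" "D \<noteq> {}"
    and neg: "bij_betw neg T T"
      "\<And>i z \<delta>. i \<in> I \<Longrightarrow> z \<in> T \<Longrightarrow> \<delta> \<in> D \<Longrightarrow> g i (neg z) \<delta> = - g i z \<delta>"
    and mean: "\<And>i \<delta>. i \<in> I \<Longrightarrow> \<delta> \<in> D \<Longrightarrow> avg T (\<lambda>z. \<bar>g i z \<delta>\<bar>) \<le> \<mu> i"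
  shows "avg (PiE I (\<lambda>_. T)) (\<lambda>z. MAX \<delta>\<in>D. (\<Sum>i\<in>I. \<bar>g i (z i) \<delta>\<bar>) + r \<delta>)
    \<le> (\<Sum>i\<in>I. \<mu> i) + avg (PiE I (\<lambda>_. T)) (\<lambda>z. MAX \<delta>\<in>D. 2 * (\<Sum>i\<in>I. g i (z i) \<delta>) + r \<delta>)"
  using I neg(2) mean
proof (induction I arbitrary: r rule: finite_induct)
  case empty
  show ?case by (simp add: avg_const)
next
  case (insert k I)
  let ?A = "avg (PiE I (\<lambda>_. T))"
  have upd: "(\<Sum>i\<in>I. \<bar>g i (if i = k then y else z i) \<delta>\<bar>) = (\<Sum>i\<in>I. \<bar>g i (z i) \<delta>\<bar>)"
    "(\<Sum>i\<in>I. g i (if i = k then y else z i) \<delta>) = (\<Sum>i\<in>I. g i (z i) \<delta>)" for z y \<delta>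
    using insert.hyps(2) by (auto intro!: sum.cong)
  have fin: "finite (PiE I (\<lambda>_. T))" "PiE I (\<lambda>_. T) \<noteq> {}"
    using insert.hyps(1) T by (auto intro!: finite_PiE simp: PiE_eq_empty_iff)
  have "avg (PiE (insert k I) (\<lambda>_. T)) (\<lambda>z. MAX \<delta>\<in>D. (\<Sum>i\<in>insert k I. \<bar>g i (z i) \<delta>\<bar>) + r \<delta>)
      = ?A (\<lambda>z. avg T (\<lambda>y. MAX \<delta>\<in>D. \<bar>g k y \<delta>\<bar> + ((\<Sum>i\<in>I. \<bar>g i (z i) \<delta>\<bar>) + r \<delta>)))"
    unfolding avg_PiE_insert[OF insert.hyps]
    using insert.hyps by (simp add: upd add.assoc)
  also have "\<dots> \<le> ?A (\<lambda>z. \<mu> k +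
      avg T (\<lambda>y. MAX \<delta>\<in>D. 2 * g k y \<delta> + ((\<Sum>i\<in>I. \<bar>g i (z i) \<delta>\<bar>) + r \<delta>)))"
    using insert.prems by (intro avg_mono avg_Max_abs_add_le[OF T D neg(1)]) auto
  also have "\<dots> = \<mu> k +
      avg T (\<lambda>y. ?A (\<lambda>z. MAX \<delta>\<in>D. (\<Sum>i\<in>I. \<bar>g i (z i) \<delta>\<bar>) + (2 * g k y \<delta> + r \<delta>)))"
    unfolding avg_add avg_const[OF fin] by (subst avg_swap) (simp add: algebra_simps)
  also have "\<dots> \<le> \<mu> k + avg T (\<lambda>y. (\<Sum>i\<in>I. \<mu> i) +
      ?A (\<lambda>z. MAX \<delta>\<in>D. 2 * (\<Sum>i\<in>I. g i (z i) \<delta>) + (2 * g k y \<delta> + r \<delta>)))"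
    using insert.prems by (intro add_left_mono avg_mono insert.IH) auto
  also have "\<dots> = (\<Sum>i\<in>insert k I. \<mu> i) +
      ?A (\<lambda>z. avg T (\<lambda>y. MAX \<delta>\<in>D. 2 * (\<Sum>i\<in>I. g i (z i) \<delta>) + (2 * g k y \<delta> + r \<delta>)))"
    unfolding avg_add avg_const[OF T] using insert.hyps by (subst avg_swap) simp
  also have "\<dots> = (\<Sum>i\<in>insert k I. \<mu> i) + avg (PiE (insert k I) (\<lambda>_. T))
      (\<lambda>z. MAX \<delta>\<in>D. 2 * (\<Sum>i\<in>insert k I. g i (z i) \<delta>) + r \<delta>)"
    unfolding avg_PiE_insert[OF insert.hyps]
    using insert.hyps by (simp add: upd algebra_simps)
  finally show ?case .
qed

section \<open>Sign vectors\<close>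

definition signs :: "'i set \<Rightarrow> ('i \<Rightarrow> real) set" where
  "signs I = I \<rightarrow>\<^sub>E {-1, 1}"

lemma finite_signs: "finite I \<Longrightarrow> finite (signs I)"
  unfolding signs_def by (intro finite_PiE) auto

lemma signs_nonempty: "signs I \<noteq> {}"
  unfolding signs_def by (simp add: PiE_eq_empty_iff)

lemma signs_cases: "x \<in> signs I \<Longrightarrow> i \<in> I \<Longrightarrow> x i = -1 \<or> x i = 1"
  unfolding signs_def by auto

lemma restrict_in_signs: "(\<And>i. i \<in> I \<Longrightarrow> x i = -1 \<or> x i = 1) \<Longrightarrow> restrict x I \<in> signs I"
  unfolding signs_def by auto

lemma signs_eq_restrict: "x \<in> signs I \<Longrightarrow> restrict x I = x"
  unfolding signs_def by (rule PiE_restrict)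

lemma bij_betw_signs_mult:
  assumes "\<And>i. i \<in> I \<Longrightarrow> s i = -1 \<or> s i = 1"
  shows "bij_betw (\<lambda>x. \<lambda>i\<in>I. s i * x i) (signs I) (signs I)"
proof (rule bij_betw_byWitness)
  have "(\<lambda>i\<in>I. s i * (\<lambda>i\<in>I. s i * x i) i) = x" if "x \<in> signs I" for x
  proof -
    have "s i * (s i * x i) = x i" if "i \<in> I" for i
      using assms[OF that] by auto
    then have "(\<lambda>i\<in>I. s i * (\<lambda>i\<in>I. s i * x i) i) = restrict x I"
      by (intro restrict_ext) simp
    then show ?thesis
      by (simp only: signs_eq_restrict[OF that])
  qed
  then show "\<forall>x\<in>signs I. (\<lambda>i\<in>I. s i * (\<lambda>i\<in>I. s i * x i) i) = x"
    "\<forall>x\<in>signs I. (\<lambda>i\<in>I. s i * (\<lambda>i\<in>I. s i * x i) i) = x"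
    by blast+
  have "s i * x i = -1 \<or> s i * x i = 1" if "x \<in> signs I" "i \<in> I" for x i
    using assms[OF that(2)] signs_cases[OF that] by auto
  then show "(\<lambda>x. \<lambda>i\<in>I. s i * x i) ` signs I \<subseteq> signs I" "(\<lambda>x. \<lambda>i\<in>I. s i * x i) ` signs I \<subseteq> signs I"
    by (blast intro: restrict_in_signs)+
qed

lemma avg_signs_mult:
  assumes "s \<in> signs I"
  shows "avg (signs I) (\<lambda>x. F (\<lambda>i\<in>I. s i * x i)) = avg (signs I) F"
  using assms by (intro avg_reindex bij_betw_signs_mult signs_cases)

lemma avg_signs_abs_sum_mult:
  assumes "s \<in> signs I"
  shows "avg (signs I) (\<lambda>x. \<bar>\<Sum>i\<in>I. x i * c i * s i\<bar>) = avg (signs I) (\<lambda>x. \<bar>\<Sum>i\<in>I. c i * x i\<bar>)"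
  using avg_signs_mult[OF assms, of "\<lambda>x. \<bar>\<Sum>i\<in>I. c i * x i\<bar>"]
  by (simp add: mult_ac)

lemma bij_betw_signs_curry:
  "bij_betw (\<lambda>\<theta>. \<lambda>i\<in>I. \<lambda>j\<in>J. \<theta> (i, j)) (signs (I \<times> J)) (PiE I (\<lambda>_. signs J))"
proof (rule bij_betw_byWitness[where f' = "\<lambda>z. \<lambda>(i, j)\<in>I \<times> J. z i j"])
  show "\<forall>\<theta>\<in>signs (I \<times> J). (\<lambda>(i, j)\<in>I \<times> J. (\<lambda>i\<in>I. \<lambda>j\<in>J. \<theta> (i, j)) i j) = \<theta>"
    unfolding signs_def by (auto simp: fun_eq_iff PiE_def extensional_def)
  show "\<forall>z\<in>PiE I (\<lambda>_. signs J). (\<lambda>i\<in>I. \<lambda>j\<in>J. (\<lambda>(i, j)\<in>I \<times> J. z i j) (i, j)) = z"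
  proof
    fix z assume z: "z \<in> PiE I (\<lambda>_. signs J)"
    have "(\<lambda>j\<in>J. (\<lambda>(i, j)\<in>I \<times> J. z i j) (i, j)) = z i" if "i \<in> I" for i
      using signs_eq_restrict[of "z i" J] PiE_mem[OF z that] that by (simp cong: restrict_cong)
    then show "(\<lambda>i\<in>I. \<lambda>j\<in>J. (\<lambda>(i, j)\<in>I \<times> J. z i j) (i, j)) = z"
      using PiE_restrict[OF z] by (simp cong: restrict_cong)
  qed
  have "\<theta> (i, j) = -1 \<or> \<theta> (i, j) = 1" if "\<theta> \<in> signs (I \<times> J)" "i \<in> I" "j \<in> J" for \<theta> i j
    using that by (intro signs_cases[of \<theta> "I \<times> J"]) auto
  then show "(\<lambda>\<theta>. \<lambda>i\<in>I. \<lambda>j\<in>J. \<theta> (i, j)) ` signs (I \<times> J) \<subseteq> PiE I (\<lambda>_. signs J)"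
    by (simp add: image_subset_iff PiE_iff restrict_in_signs)
  show "(\<lambda>z. \<lambda>(i, j)\<in>I \<times> J. z i j) ` PiE I (\<lambda>_. signs J) \<subseteq> signs (I \<times> J)"
    by (auto intro!: restrict_in_signs dest: PiE_mem signs_cases)
qed

lemma bij_betw_flip_rows:
  assumes "w \<in> signs I"
  shows "bij_betw (\<lambda>z. \<lambda>i\<in>I. \<lambda>j\<in>J. w i * z i j) (PiE I (\<lambda>_. signs J)) (PiE I (\<lambda>_. signs J))"
    (is "bij_betw ?flip ?Z ?Z")
proof (rule bij_betw_byWitness)
  have "?flip (?flip z) = z" if z: "z \<in> ?Z" for z
  proof -
    have "(\<lambda>j\<in>J. w i * ?flip z i j) = z i" if i: "i \<in> I" for i
    proof -
      have "w i * (w i * z i j) = z i j" for j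
        using signs_cases[OF assms i] by auto
      then have "(\<lambda>j\<in>J. w i * ?flip z i j) = restrict (z i) J"
        using i by (intro restrict_ext) simp
      then show ?thesis
        by (simp only: signs_eq_restrict[OF PiE_mem[OF z i]])
    qed
    then have "?flip (?flip z) = restrict z I"
      by (intro restrict_ext) simp
    then show ?thesis
      by (simp only: PiE_restrict[OF z])
  qed
  then show "\<forall>z\<in>?Z. ?flip (?flip z) = z" "\<forall>z\<in>?Z. ?flip (?flip z) = z"
    by blast+
  have "w i * z i j = -1 \<or> w i * z i j = 1" if "z \<in> ?Z" "i \<in> I" "j \<in> J" for z i j
    using signs_cases[OF assms that(2)] signs_cases[OF PiE_mem[OF that(1,2)] that(3)] by auto
  then show "?flip ` ?Z \<subseteq> ?Z" "?flip ` ?Z \<subseteq> ?Z"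
    by (simp_all add: image_subset_iff restrict_PiE_iff restrict_in_signs)
qed

section \<open>Random signs in a bilinear form\<close>

text \<open>
  The number \<open>L\<close> is a bound for the norm of the bilinear form \<open>a\<close> on sign vectors; it bounds the
  two mixed averages because optimal signs \<open>\<epsilon>\<close> (or \<open>\<delta>\<close>) turn the absolute values into the form.
\<close>

lemma sum_abs_rows_le:
  fixes a :: "'i \<Rightarrow> 'j \<Rightarrow> real"
  assumes L: "\<And>\<epsilon> \<delta>. \<epsilon> \<in> signs I \<Longrightarrow> \<delta> \<in> signs J \<Longrightarrow> \<bar>\<Sum>i\<in>I. \<Sum>j\<in>J. a i j * (\<epsilon> i * \<delta> j)\<bar> \<le> L"
    and \<delta>: "\<delta> \<in> signs J"
  shows "(\<Sum>i\<in>I. \<bar>\<Sum>j\<in>J. a i j * \<delta> j\<bar>) \<le> L"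
proof -
  define \<epsilon> where "\<epsilon> = (\<lambda>i\<in>I. if (\<Sum>j\<in>J. a i j * \<delta> j) \<ge> 0 then 1 else - 1 :: real)"
  have "\<epsilon> \<in> signs I"
    unfolding signs_def \<epsilon>_def by auto
  have "(\<Sum>i\<in>I. \<bar>\<Sum>j\<in>J. a i j * \<delta> j\<bar>) = (\<Sum>i\<in>I. \<epsilon> i * (\<Sum>j\<in>J. a i j * \<delta> j))"
    by (intro sum.cong) (auto simp: \<epsilon>_def)
  also have "\<dots> = (\<Sum>i\<in>I. \<Sum>j\<in>J. a i j * (\<epsilon> i * \<delta> j))"
    by (simp add: sum_distrib_left mult_ac)
  also have "\<dots> \<le> L"
    using L[OF \<open>\<epsilon> \<in> signs I\<close> \<delta>] by linarith
  finally show ?thesis .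
qed

lemma sum_abs_columns_le:
  fixes a :: "'i \<Rightarrow> 'j \<Rightarrow> real"
  assumes L: "\<And>\<epsilon> \<delta>. \<epsilon> \<in> signs I \<Longrightarrow> \<delta> \<in> signs J \<Longrightarrow> \<bar>\<Sum>i\<in>I. \<Sum>j\<in>J. a i j * (\<epsilon> i * \<delta> j)\<bar> \<le> L"
    and \<epsilon>: "\<epsilon> \<in> signs I"
  shows "(\<Sum>j\<in>J. \<bar>\<Sum>i\<in>I. a i j * \<epsilon> i\<bar>) \<le> L"
proof (rule sum_abs_rows_le[OF _ \<epsilon>])
  fix \<delta> \<epsilon> assume "\<delta> \<in> signs J" "\<epsilon> \<in> signs I"
  then show "\<bar>\<Sum>j\<in>J. \<Sum>i\<in>I. a i j * (\<delta> j * \<epsilon> i)\<bar> \<le> L"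
    using L[of \<epsilon> \<delta>] by (subst sum.swap) (simp add: mult_ac)
qed

text \<open>
  The maximum is attained when \<open>\<delta> j\<close> is the sign of the sum over the \<open>j\<close>-th column. Flipping whole
  rows of \<open>z\<close> by a sign vector \<open>w\<close> does not change the average; with \<open>z\<close> fixed, averaging over \<open>w\<close>
  makes each column uniformly distributed, so that \<open>z\<close> disappears.
\<close>

lemma avg_Max_sum_le:
  fixes a :: "'i \<Rightarrow> 'j \<Rightarrow> real"
  assumes I: "finite I" and J: "finite J"
    and L: "\<And>\<epsilon> \<delta>. \<epsilon> \<in> signs I \<Longrightarrow> \<delta> \<in> signs J \<Longrightarrow> \<bar>\<Sum>i\<in>I. \<Sum>j\<in>J. a i j * (\<epsilon> i * \<delta> j)\<bar> \<le> L"
  shows "avg (PiE I (\<lambda>_. signs J)) (\<lambda>z. MAX \<delta>\<in>signs J. 2 * (\<Sum>i\<in>I. \<Sum>j\<in>J. z i j * a i j * \<delta> j))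
    \<le> 2 * L"
proof -
  let ?A = "avg (PiE I (\<lambda>_. signs J))"
  have fin: "finite (PiE I (\<lambda>_. signs J))" "PiE I (\<lambda>_. signs J) \<noteq> {}"
    using I J by (auto intro!: finite_PiE finite_signs simp: PiE_eq_empty_iff signs_nonempty)
  define H where "H z = (\<Sum>j\<in>J. \<bar>\<Sum>i\<in>I. a i j * z i j\<bar>)" for z
  have "(MAX \<delta>\<in>signs J. 2 * (\<Sum>i\<in>I. \<Sum>j\<in>J. z i j * a i j * \<delta> j)) \<le> 2 * H z" for z
  proof -
    have "2 * (\<Sum>i\<in>I. \<Sum>j\<in>J. z i j * a i j * \<delta> j) \<le> 2 * H z" if \<delta>: "\<delta> \<in> signs J" for \<delta>
    proof -
      have "(\<Sum>i\<in>I. \<Sum>j\<in>J. z i j * a i j * \<delta> j) = (\<Sum>j\<in>J. (\<Sum>i\<in>I. a i j * z i j) * \<delta> j)"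
        by (subst sum.swap) (simp add: sum_distrib_left mult_ac)
      also have "\<dots> \<le> H z"
        unfolding H_def using signs_cases[OF \<delta>] by (intro sum_mono) force
      finally show ?thesis by simp
    qed
    then show ?thesis
      using J by (subst Max_le_iff) (auto simp: finite_signs signs_nonempty)
  qed
  then have "?A (\<lambda>z. MAX \<delta>\<in>signs J. 2 * (\<Sum>i\<in>I. \<Sum>j\<in>J. z i j * a i j * \<delta> j)) \<le> 2 * ?A H"
    unfolding avg_mult_left[symmetric] by (rule avg_mono)
  also have "?A H = avg (signs I) (\<lambda>w. ?A (\<lambda>z. H (\<lambda>i\<in>I. \<lambda>j\<in>J. w i * z i j)))"
  proof -
    have "avg (signs I) (\<lambda>w. ?A (\<lambda>z. H (\<lambda>i\<in>I. \<lambda>j\<in>J. w i * z i j))) = avg (signs I) (\<lambda>w. ?A H)"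
      by (intro avg_cong avg_reindex bij_betw_flip_rows)
    then show ?thesis
      using I by (simp add: avg_const finite_signs signs_nonempty)
  qed
  also have "\<dots> = ?A (\<lambda>z. avg (signs I) (\<lambda>w. \<Sum>j\<in>J. \<bar>\<Sum>i\<in>I. w i * a i j * z i j\<bar>))"
    by (subst avg_swap) (simp add: H_def mult_ac)
  also have "\<dots> = ?A (\<lambda>z. \<Sum>j\<in>J. avg (signs I) (\<lambda>w. \<bar>\<Sum>i\<in>I. a i j * w i\<bar>))"
    unfolding avg_sum
  proof (rule sum.cong[OF refl], rule avg_cong)
    fix z j assume zj: "z \<in> PiE I (\<lambda>_. signs J)" "j \<in> J"
    then have "(\<lambda>i\<in>I. z i j) \<in> signs I"
      by (intro restrict_in_signs) (auto dest: PiE_mem signs_cases)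
    from avg_signs_abs_sum_mult[OF this, of "\<lambda>i. a i j"]
    show "avg (signs I) (\<lambda>w. \<bar>\<Sum>i\<in>I. w i * a i j * z i j\<bar>)
        = avg (signs I) (\<lambda>w. \<bar>\<Sum>i\<in>I. a i j * w i\<bar>)"
      by simp
  qed
  also have "\<dots> = avg (signs I) (\<lambda>w. \<Sum>j\<in>J. \<bar>\<Sum>i\<in>I. a i j * w i\<bar>)"
    by (simp add: avg_const[OF fin] avg_sum)
  also have "\<dots> \<le> L"
    using I L by (intro avg_le sum_abs_columns_le) (auto simp: finite_signs signs_nonempty)
  finally show ?thesis by simp
qed

text \<open>
  The mean \<open>\<mu> i\<close> of \<open>\<bar>f\<^sub>i(\<theta>, \<delta>)\<bar>\<close> does not depend on \<open>\<delta>\<close>, as multiplying a random row by \<open>\<delta>\<close> does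
  not change its distribution. Hence all the means are realized by the same random sign vector, and
  their sum is an average of the sums bounded in \<open>sum_abs_rows_le\<close>.
\<close>

theorem avg_Max_sum_abs_random_signs_le:
  fixes a :: "'i \<Rightarrow> 'j \<Rightarrow> real"
  assumes I: "finite I" and J: "finite J"
    and L: "\<And>\<epsilon> \<delta>. \<epsilon> \<in> signs I \<Longrightarrow> \<delta> \<in> signs J \<Longrightarrow> \<bar>\<Sum>i\<in>I. \<Sum>j\<in>J. a i j * (\<epsilon> i * \<delta> j)\<bar> \<le> L"
  shows "avg (signs (I \<times> J)) (\<lambda>\<theta>. MAX \<delta>\<in>signs J. \<Sum>i\<in>I. \<bar>\<Sum>j\<in>J. \<theta> (i, j) * a i j * \<delta> j\<bar>) \<le> 3 * L"
proof -
  let ?A = "avg (PiE I (\<lambda>_. signs J))"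
  define g where "g i x \<delta> = (\<Sum>j\<in>J. x j * a i j * \<delta> j)" for i x \<delta>
  define \<mu> where "\<mu> i = avg (signs J) (\<lambda>x. \<bar>\<Sum>j\<in>J. a i j * x j\<bar>)" for i
  have fin: "finite (signs J)" "signs J \<noteq> {}"
    using J by (auto simp: finite_signs signs_nonempty)
  have "(\<Sum>i\<in>I. \<mu> i) = avg (signs J) (\<lambda>x. \<Sum>i\<in>I. \<bar>\<Sum>j\<in>J. a i j * x j\<bar>)"
    unfolding \<mu>_def by (simp add: avg_sum)
  also have "\<dots> \<le> L"
    using L by (intro avg_le[OF fin] sum_abs_rows_le)
  finally have rows: "(\<Sum>i\<in>I. \<mu> i) \<le> L" .
  have "avg (signs (I \<times> J)) (\<lambda>\<theta>. MAX \<delta>\<in>signs J. \<Sum>i\<in>I. \<bar>\<Sum>j\<in>J. \<theta> (i, j) * a i j * \<delta> j\<bar>)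
      = ?A (\<lambda>z. MAX \<delta>\<in>signs J. (\<Sum>i\<in>I. \<bar>g i (z i) \<delta>\<bar>) + 0)"
    unfolding g_def avg_reindex[OF bij_betw_signs_curry, symmetric] by simp
  also have "\<dots> \<le> (\<Sum>i\<in>I. \<mu> i) + ?A (\<lambda>z. MAX \<delta>\<in>signs J. 2 * (\<Sum>i\<in>I. g i (z i) \<delta>) + 0)"
  proof (rule avg_Max_sum_abs_le[OF I fin fin])
    show "bij_betw (\<lambda>x. \<lambda>j\<in>J. - 1 * x j) (signs J) (signs J)"
      by (rule bij_betw_signs_mult) auto
    show "g i (\<lambda>j\<in>J. - 1 * x j) \<delta> = - g i x \<delta>" for i x \<delta>
      by (simp add: g_def sum_negf)
    show "avg (signs J) (\<lambda>x. \<bar>g i x \<delta>\<bar>) \<le> \<mu> i" if "\<delta> \<in> signs J" for i \<delta>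
      using avg_signs_abs_sum_mult[OF that, of "a i"] by (simp add: g_def \<mu>_def)
  qed
  also have "\<dots> \<le> L + 2 * L"
    using rows avg_Max_sum_le[OF I J L] by (intro add_mono) (simp_all add: g_def)
  finally show ?thesis by simp
qed

section \<open>Rademacher sums and sign vectors\<close>

text \<open>
  The first \<open>n\<close> Rademacher functions record the first \<open>n\<close> binary digits, so they are constant on
  dyadic intervals of length \<open>2\<^sup>-\<^sup>n\<close>; prescribing one more sign selects one half of the interval.
\<close>

lemma rademacher_prescribed_signs:
  assumes "\<And>i. i \<in> {1..n} \<Longrightarrow> \<epsilon> i = -1 \<or> \<epsilon> i = (1 :: real)"
  obtains k :: nat where "k < 2 ^ n"
    "\<And>t i. real k / 2 ^ n < t \<Longrightarrow> t < (real k + 1) / 2 ^ n \<Longrightarrow> i \<in> {1..n} \<Longrightarrow> rademacher i t = \<epsilon> i"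
proof -
  have "\<exists>k :: nat. k < 2 ^ n \<and> (\<forall>t i. real k / 2 ^ n < t \<longrightarrow> t < (real k + 1) / 2 ^ n \<longrightarrow>
      i \<in> {1..n} \<longrightarrow> rademacher i t = \<epsilon> i)"
    using assms
  proof (induction n)
    case 0
    show ?case by auto
  next
    case (Suc n)
    then obtain k :: nat where k: "k < 2 ^ n"
      "\<And>t i. real k / 2 ^ n < t \<Longrightarrow> t < (real k + 1) / 2 ^ n \<Longrightarrow> i \<in> {1..n} \<Longrightarrow> rademacher i t = \<epsilon> i"
      by (metis atLeastAtMost_iff le_SucI)
    define b :: nat where "b = (if \<epsilon> (Suc n) = 1 then 0 else 1)"
    have b: "b = 0 \<or> b = 1" by (auto simp: b_def)
    have "rademacher i t = \<epsilon> i"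
      if t: "real (2 * k + b) / 2 ^ Suc n < t" "t < (real (2 * k + b) + 1) / 2 ^ Suc n"
        and i: "i \<in> {1..Suc n}" for t i
    proof (cases "i = Suc n")
      case True
      have "\<lfloor>2 ^ Suc n * t\<rfloor> = int (2 * k + b)"
        using t by (intro floor_unique) (simp_all add: field_simps)
      then have "rademacher i t = (-1) ^ (2 * k + b)"
        unfolding rademacher_def True by (simp only: power_int_of_nat)
      also have "\<dots> = \<epsilon> i"
        using Suc.prems[of "Suc n"] True by (auto simp: b_def)
      finally show ?thesis .
    next
      case False
      have "real k / 2 ^ n < t" "t < (real k + 1) / 2 ^ n"
        using t b by (auto simp: field_simps)
      then show ?thesis
        using k(2) i False by auto
    qed
    moreover have "2 * k + b < 2 ^ Suc n"
      using k(1) b by auto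
    ultimately show ?case by blast
  qed
  then show thesis using that by blast
qed

lemma Linf_norm_le:
  fixes b :: "nat \<Rightarrow> nat \<Rightarrow> real"
  assumes "\<And>\<epsilon> \<delta>. \<epsilon> \<in> signs {1..n} \<Longrightarrow> \<delta> \<in> signs {1..m} \<Longrightarrow>
    \<bar>\<Sum>i=1..n. \<Sum>j=1..m. b i j * (\<epsilon> i * \<delta> j)\<bar> \<le> c"
  shows "Linf_norm unit_square (\<lambda>x. \<Sum>i=1..n. \<Sum>j=1..m. b i j * rademacher_tensor i j x) \<le> c"
    (is "Linf_norm _ ?f \<le> c")
proof -
  have "\<bar>?f (u, v)\<bar> \<le> c" for u v :: real
  proof -
    have "rademacher i t = -1 \<or> rademacher i t = 1" for i t
      using abs_rademacher[of i t] by linarith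
    then have "(\<lambda>i\<in>{1..k}. rademacher i t) \<in> signs {1..k}" for k :: nat and t
      by (auto simp: signs_def)
    from assms[OF this[of u n] this[of v m]] show ?thesis
      by (simp add: rademacher_tensor_def)
  qed
  moreover have "?f \<in> borel_measurable unit_square"
    by (intro borel_measurable_sum borel_measurable_times borel_measurable_const
        borel_measurable_rademacher_tensor)
  ultimately have "esssup unit_square (\<lambda>x. ereal \<bar>?f x\<bar>) \<le> ereal c"
    by (intro esssup_I) (auto simp del: ereal_less_eq(3) simp: ereal_less_eq(3))
  then show ?thesis
    unfolding ereal_Linf_norm_rademacher_sum[symmetric] by simp
qed

text \<open>
  The value of the form at a pair of sign vectors is taken by the function on an open rectangle,
  and an inequality that holds almost everywhere must hold at some point of it.
\<close>

lemma sign_form_le_Linf_norm: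
  fixes b :: "nat \<Rightarrow> nat \<Rightarrow> real"
  assumes \<epsilon>: "\<epsilon> \<in> signs {1..n}" and \<delta>: "\<delta> \<in> signs {1..m}"
  shows "\<bar>\<Sum>i=1..n. \<Sum>j=1..m. b i j * (\<epsilon> i * \<delta> j)\<bar>
    \<le> Linf_norm unit_square (\<lambda>x. \<Sum>i=1..n. \<Sum>j=1..m. b i j * rademacher_tensor i j x)"
    (is "_ \<le> Linf_norm _ ?f")
proof -
  obtain k :: nat where k: "k < 2 ^ n"
    "\<And>t i. real k / 2 ^ n < t \<Longrightarrow> t < (real k + 1) / 2 ^ n \<Longrightarrow> i \<in> {1..n} \<Longrightarrow> rademacher i t = \<epsilon> i"
    using rademacher_prescribed_signs[of n \<epsilon>] signs_cases[OF \<epsilon>] by blast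
  obtain l :: nat where l: "l < 2 ^ m"
    "\<And>t j. real l / 2 ^ m < t \<Longrightarrow> t < (real l + 1) / 2 ^ m \<Longrightarrow> j \<in> {1..m} \<Longrightarrow> rademacher j t = \<delta> j"
    using rademacher_prescribed_signs[of m \<delta>] signs_cases[OF \<delta>] by blast
  define R where "R = {real k / 2 ^ n<..<(real k + 1) / 2 ^ n} \<times> {real l / 2 ^ m<..<(real l + 1) / 2 ^ m}"
  have "real q / 2 ^ p < (real q + 1) / 2 ^ p" for q p :: nat
    by (rule divide_strict_right_mono) auto
  then have "open R" "R \<noteq> {}"
    by (simp_all add: R_def open_Times not_le)
  then have not_null: "R \<notin> null_sets lebesgue"
    using open_not_negligible[of R] by (simp add: negligible_iff_null_sets)
  have dyadic: "{real q / 2 ^ p<..<(real q + 1) / 2 ^ p} \<subseteq> {0..1}" if "q < 2 ^ p" for p q :: nat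
  proof -
    have "real q + 1 \<le> 2 ^ p"
      using that by (metis Suc_leI of_nat_Suc of_nat_le_iff of_nat_numeral of_nat_power add.commute)
    then have "(real q + 1) / 2 ^ p \<le> 1" "0 \<le> real q / 2 ^ p"
      by simp_all
    then show ?thesis
      by (meson atLeastAtMost_iff greaterThanLessThan_iff less_imp_le order_trans subsetI)
  qed
  have R_subset: "R \<subseteq> {0..1} \<times> {0..1}"
    unfolding R_def using dyadic[OF k(1)] dyadic[OF l(1)] by (rule Sigma_mono)
  have "AE x in unit_square. ereal \<bar>?f x\<bar> \<le> ereal (Linf_norm unit_square ?f)"
    unfolding ereal_Linf_norm_rademacher_sum by (rule esssup_AE)
  then have "AE x in lebesgue. x \<in> {0..1} \<times> {0..1} \<longrightarrow> \<bar>?f x\<bar> \<le> Linf_norm unit_square ?f"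
  proof (subst (asm) AE_restrict_space_iff)
    have "closed ({0..1} \<times> {0..1} :: (real \<times> real) set)"
      by (intro closed_Times closed_atLeastAtMost)
    then show "{0..1} \<times> {0..1} \<inter> space lebesgue \<in> sets (lebesgue :: (real \<times> real) measure)"
      by (auto intro: sets_completionI_sets borel_closed)
  qed simp
  then obtain N where N: "N \<in> null_sets lebesgue"
    "{x. \<not> (x \<in> {0..1} \<times> {0..1} \<longrightarrow> \<bar>?f x\<bar> \<le> Linf_norm unit_square ?f)} \<subseteq> N"
    unfolding eventually_ae_filter by auto
  obtain x where x: "x \<in> R" "\<bar>?f x\<bar> \<le> Linf_norm unit_square ?f"
  proof (rule ccontr)
    assume "\<not> thesis"
    then have "R \<subseteq> N" using N(2) R_subset that by blast
    moreover have "R \<in> sets lebesgue" using \<open>open R\<close> by auto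
    ultimately show False
      using not_null null_sets_subset[OF N(1)] by blast
  qed
  have "rademacher_tensor i j x = \<epsilon> i * \<delta> j" if "i \<in> {1..n}" "j \<in> {1..m}" for i j
    using x(1) k(2)[of "fst x" i] l(2)[of "snd x" j] that
    by (auto simp: R_def rademacher_tensor_def)
  then have "?f x = (\<Sum>i=1..n. \<Sum>j=1..m. b i j * (\<epsilon> i * \<delta> j))"
    by (intro sum.cong) auto
  then show ?thesis
    using x(2) by simp
qed

lemma Linf_norm_le_Max:
  fixes b :: "nat \<Rightarrow> nat \<Rightarrow> real"
  shows "Linf_norm unit_square (\<lambda>x. \<Sum>i=1..n. \<Sum>j=1..m. b i j * rademacher_tensor i j x)
    \<le> (MAX \<delta>\<in>signs {1..m}. \<Sum>i=1..n. \<bar>\<Sum>j=1..m. b i j * \<delta> j\<bar>)"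
proof (rule Linf_norm_le)
  fix \<epsilon> \<delta> assume \<epsilon>: "\<epsilon> \<in> signs {1..n}" and \<delta>: "\<delta> \<in> signs {1..m}"
  have "\<bar>\<Sum>i=1..n. \<Sum>j=1..m. b i j * (\<epsilon> i * \<delta> j)\<bar> \<le> (\<Sum>i=1..n. \<bar>\<Sum>j=1..m. b i j * (\<epsilon> i * \<delta> j)\<bar>)"
    by (rule sum_abs)
  also have "\<dots> = (\<Sum>i=1..n. \<bar>\<Sum>j=1..m. b i j * \<delta> j\<bar>)"
  proof (intro sum.cong refl)
    fix i assume "i \<in> {1..n}"
    then have "\<bar>\<epsilon> i\<bar> = 1" using signs_cases[OF \<epsilon>] by force
    moreover have "(\<Sum>j=1..m. b i j * (\<epsilon> i * \<delta> j)) = \<epsilon> i * (\<Sum>j=1..m. b i j * \<delta> j)"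
      by (simp add: sum_distrib_left mult_ac)
    ultimately show "\<bar>\<Sum>j=1..m. b i j * (\<epsilon> i * \<delta> j)\<bar> = \<bar>\<Sum>j=1..m. b i j * \<delta> j\<bar>"
      by (simp add: abs_mult)
  qed
  also have "\<dots> \<le> (MAX \<delta>\<in>signs {1..m}. \<Sum>i=1..n. \<bar>\<Sum>j=1..m. b i j * \<delta> j\<bar>)"
    using \<delta> by (intro Max_ge) (auto simp: finite_signs)
  finally show "\<bar>\<Sum>i=1..n. \<Sum>j=1..m. b i j * (\<epsilon> i * \<delta> j)\<bar> \<le> \<dots>" .
qed

lemma sign_expectation_eq_avg: "sign_expectation n m F = avg (signs ({1..n} \<times> {1..m})) F"
  using finite_signs[of "{1..n} \<times> {1..m}"] signs_nonempty[of "{1..n} \<times> {1..m}"]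
  unfolding sign_expectation_def sign_arrangements_def avg_def signs_def
  by (subst integral_pmf_of_set) auto

section \<open>Random unconditional convergence\<close>

theorem corollary2:
  shows "\<exists>C :: real. C > 0 \<and> (\<forall>(n :: nat) (m :: nat) (a :: nat \<Rightarrow> nat \<Rightarrow> real).
    sign_expectation n m (\<lambda>\<theta>. Linf_norm unit_square
        (\<lambda>x. \<Sum>i=1..n. \<Sum>j=1..m. \<theta> (i, j) * a i j * rademacher_tensor i j x))
      \<le> C * Linf_norm unit_square
        (\<lambda>x. \<Sum>i=1..n. \<Sum>j=1..m. a i j * rademacher_tensor i j x))"
proof (intro exI[of _ 3] conjI allI)
  fix n m :: nat and a :: "nat \<Rightarrow> nat \<Rightarrow> real"
  let ?L = "Linf_norm unit_square (\<lambda>x. \<Sum>i=1..n. \<Sum>j=1..m. a i j * rademacher_tensor i j x)"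
  have "sign_expectation n m (\<lambda>\<theta>. Linf_norm unit_square
        (\<lambda>x. \<Sum>i=1..n. \<Sum>j=1..m. \<theta> (i, j) * a i j * rademacher_tensor i j x))
      \<le> avg (signs ({1..n} \<times> {1..m}))
        (\<lambda>\<theta>. MAX \<delta>\<in>signs {1..m}. \<Sum>i=1..n. \<bar>\<Sum>j=1..m. \<theta> (i, j) * a i j * \<delta> j\<bar>)"
    unfolding sign_expectation_eq_avg by (intro avg_mono Linf_norm_le_Max)
  also have "\<dots> \<le> 3 * ?L"
    by (intro avg_Max_sum_abs_random_signs_le sign_form_le_Linf_norm) auto
  finally show "sign_expectation n m (\<lambda>\<theta>. Linf_norm unit_square
        (\<lambda>x. \<Sum>i=1..n. \<Sum>j=1..m. \<theta> (i, j) * a i j * rademacher_tensor i j x)) \<le> 3 * ?L" .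
qed simp

end
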